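(* Let $\alpha=(\alpha_1,\dots,\alpha_n)$ be a composition, $w_0=(n,\dots,1)$, and let $F\in\mathrm{CoInvFree}(\alpha,w_0)$. Then $\mathrm{charge}(\mathrm{cw}(F))=\mathrm{maj}(F)$.
   Context: Fillings: the augmented diagram of shape $\alpha$ has $n$ rows (top to bottom), row $r$ consisting of boxes $(r,0),\dots,(r,\alpha_r)$, column $0$ the basement; a filling with basement $w_0$ has $F(r,0)=n+1-r$ and non-basement entries in $\{1,\dots,n\}$. Boxes $u,v$ attack if $F(u)=F(v)$ and they are in the same column, or in adjacent columns with the right one strictly lower. A type $A$ triple is $a=(r,j-1)$, $b=(r,j)$, $c=(k,j)$ with $j\ge1$, $k>r$, $\alpha_r\ge\alpha_k$; a type $B$ triple is $a=(r,j-1)$, $b=(r,j)$, $c=(k,j-1)$ with $j\ge1$, $k<r$, $\alpha_r>\alpha_k$. Compare entries by value, ties broken with $a$ largest, then $c$, then $b$. A type $A$ (resp. $B$) triple is an inversion triple if its entries in increasing order form a cyclic rotation of $(a,c,b)$ (resp. $(c,b,a)$); otherwise it is a coinversion triple. $\mathrm{CoInvFree}(\alpha,w_0)$ is the set of non-attacking fillings with basement $w_0$ and no coinversion triples. A non-basement box $b$ is a descent if $F(a)<F(b)$ for the box $a$ immediately left of $b$; $\mathrm{maj}(F)=\sum_{b\text{ descent}}(\mathrm{leg}(b)+1)$, where $\mathrm{leg}(b)$ is the number of boxes to the right of $b$ in its row. Charge word: number the non-basement columns $1,2,3,\dots$ from left to right. Form a two-line array whose top row lists all non-basement entries of $F$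 in weakly increasing order and whose bottom row lists, below each entry, the column it lies in; among equal top entries, the column numbers are listed in decreasing order. $\mathrm{cw}(F)$ is the bottom row (a word whose content, i.e. the multiplicities of $1,2,\dots$, is a partition). Charge: for a word $w$ in letters $1,\dots,m$ whose content is a partition (at least as many $i$'s as $(i+1)$'s), extract standard subwords iteratively: take the rightmost occurrence of $1$; from there scan leftwards, wrapping cyclically from the left end to the right end, to the first occurrence of $2$; from there continue scanning leftwards cyclically to the first occurrence of $3$; and so on until an occurrence of the largest letter present has been taken. The chosen letters, in the order they occur in $w$, form a permutation $u$ (a subword); remove them and repeat on the remaining letters until none remain. For a permutation $u$, $\mathrm{charge}(u)=\mathrm{maj}(\mathrm{reverse}(u^{-1}))$, where $\mathrm{maj}(v_1\cdots v_m)=\sum\{i: v_i>v_{i+1}\}$. Then $\mathrm{charge}(w)$ is the sum of the charges of its standard subwords. *)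

theory Defs
  imports Main
begin

section \<open>Fillings of augmented diagrams\<close>

text \<open>
  A composition \<open>\<alpha>\<close> with \<open>n\<close> parts (zero parts allowed) is a list of length \<open>n\<close>; rows and parts
  are numbered from 1, row 1 being the topmost row. A box is a pair (row, column).
\<close>

definition part :: "nat list \<Rightarrow> nat \<Rightarrow> nat" where
  "part \<alpha> r = \<alpha> ! (r - 1)"

definition aug_diagram :: "nat list \<Rightarrow> (nat \<times> nat) set" where
  "aug_diagram \<alpha> = {(r, j). 1 \<le> r \<and> r \<le> length \<alpha> \<and> j \<le> part \<alpha> r}"

definition diagram :: "nat list \<Rightarrow> (nat \<times> nat) set" where
  "diagram \<alpha> = {(r, j) \<in> aug_diagram \<alpha>. 1 \<le> j}"

text \<open>
  A filling is a function on all pairs; only its values on the augmented diagram matter.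
  The basement is given as a word \<open>\<sigma>\<close>, read from top to bottom.
\<close>

definition is_filling :: "nat list \<Rightarrow> nat list \<Rightarrow> (nat \<times> nat \<Rightarrow> nat) \<Rightarrow> bool" where
  "is_filling \<alpha> \<sigma> F \<longleftrightarrow>
     (\<forall>r. 1 \<le> r \<and> r \<le> length \<alpha> \<longrightarrow> F (r, 0) = \<sigma> ! (r - 1)) \<and>
     (\<forall>b \<in> diagram \<alpha>. F b \<in> {1..length \<alpha>})"

definition w0 :: "nat \<Rightarrow> nat list" where
  "w0 n = rev [1..<Suc n]"

definition attack :: "(nat \<times> nat \<Rightarrow> nat) \<Rightarrow> nat \<times> nat \<Rightarrow> nat \<times> nat \<Rightarrow> bool" where
  "attack F u v \<longleftrightarrow> u \<noteq> v \<and> F u = F v \<and>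
     (snd u = snd v \<or>
      (snd v = snd u + 1 \<and> fst v > fst u) \<or>
      (snd u = snd v + 1 \<and> fst u > fst v))"

definition non_attacking :: "nat list \<Rightarrow> (nat \<times> nat \<Rightarrow> nat) \<Rightarrow> bool" where
  "non_attacking \<alpha> F \<longleftrightarrow> (\<forall>u \<in> aug_diagram \<alpha>. \<forall>v \<in> aug_diagram \<alpha>. \<not> attack F u v)"

type_synonym triple = "(nat \<times> nat) \<times> (nat \<times> nat) \<times> (nat \<times> nat)"

definition type_A_triples :: "nat list \<Rightarrow> triple set" where
  "type_A_triples \<alpha> = {((r, j - 1), (r, j), (k, j)) | r k j.
     1 \<le> j \<and> r < k \<and> part \<alpha> k \<le> part \<alpha> r \<and>
     (r, j) \<in> aug_diagram \<alpha> \<and> (k, j) \<in> aug_diagram \<alpha>}"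

definition type_B_triples :: "nat list \<Rightarrow> triple set" where
  "type_B_triples \<alpha> = {((r, j - 1), (r, j), (k, j - 1)) | r k j.
     1 \<le> j \<and> k < r \<and> part \<alpha> k < part \<alpha> r \<and>
     (r, j) \<in> aug_diagram \<alpha> \<and> (k, j - 1) \<in> aug_diagram \<alpha>}"

datatype triple_box = Box_a | Box_b | Box_c

text \<open>
  The sort is stable, so listing the boxes as \<open>b, c, a\<close> beforehand resolves ties
  with \<open>a\<close> largest, then \<open>c\<close>, then \<open>b\<close>.
\<close>

fun increasing_order :: "(nat \<times> nat \<Rightarrow> nat) \<Rightarrow> triple \<Rightarrow> triple_box list" where
  "increasing_order F (a, b, c) =
     map snd (sort_key fst [(F b, Box_b), (F c, Box_c), (F a, Box_a)])"

definition inversion_A :: "(nat \<times> nat \<Rightarrow> nat) \<Rightarrow> triple \<Rightarrow> bool" where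
  "inversion_A F t \<longleftrightarrow> (\<exists>i. increasing_order F t = rotate i [Box_a, Box_c, Box_b])"

definition inversion_B :: "(nat \<times> nat \<Rightarrow> nat) \<Rightarrow> triple \<Rightarrow> bool" where
  "inversion_B F t \<longleftrightarrow> (\<exists>i. increasing_order F t = rotate i [Box_c, Box_b, Box_a])"

definition CoInvFree :: "nat list \<Rightarrow> nat list \<Rightarrow> (nat \<times> nat \<Rightarrow> nat) set" where
  "CoInvFree \<alpha> \<sigma> = {F. is_filling \<alpha> \<sigma> F \<and> non_attacking \<alpha> F \<and>
     (\<forall>t \<in> type_A_triples \<alpha>. inversion_A F t) \<and>
     (\<forall>t \<in> type_B_triples \<alpha>. inversion_B F t)}"

definition leg :: "nat list \<Rightarrow> nat \<times> nat \<Rightarrow> nat" where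
  "leg \<alpha> b = card {j. snd b < j \<and> (fst b, j) \<in> diagram \<alpha>}"

definition descents :: "nat list \<Rightarrow> (nat \<times> nat \<Rightarrow> nat) \<Rightarrow> (nat \<times> nat) set" where
  "descents \<alpha> F = {(r, j) \<in> diagram \<alpha>. F (r, j - 1) < F (r, j)}"

definition maj :: "nat list \<Rightarrow> (nat \<times> nat \<Rightarrow> nat) \<Rightarrow> nat" where
  "maj \<alpha> F = (\<Sum>b \<in> descents \<alpha> F. leg \<alpha> b + 1)"


section \<open>Charge word\<close>

text \<open>
  The columns of the array are the pairs (entry, column number). They are first listed by
  decreasing column number; the stable sort by entry keeps this order among equal entries.
\<close>

definition two_line_array :: "nat list \<Rightarrow> (nat \<times> nat \<Rightarrow> nat) \<Rightarrow> (nat \<times> nat) list" where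
  "two_line_array \<alpha> F = sort_key fst
     [(F (r, j), j). j \<leftarrow> rev [1..<Suc (foldr max \<alpha> 0)], r \<leftarrow> [1..<Suc (length \<alpha>)], j \<le> part \<alpha> r]"

definition cw :: "nat list \<Rightarrow> (nat \<times> nat \<Rightarrow> nat) \<Rightarrow> nat list" where
  "cw \<alpha> F = map snd (two_line_array \<alpha> F)"


section \<open>Charge\<close>

definition word_maj :: "nat list \<Rightarrow> nat" where
  "word_maj v = \<Sum>{i. 1 \<le> i \<and> i < length v \<and> v ! (i - 1) > v ! i}"

text \<open>For a permutation of \<open>1, \<dots>, m\<close> in one-line notation.\<close>

definition perm_inverse :: "nat list \<Rightarrow> nat list" where
  "perm_inverse u = map (\<lambda>i. Suc (length (takeWhile (\<lambda>x. x \<noteq> i) u))) [1..<Suc (length u)]"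

definition perm_charge :: "nat list \<Rightarrow> nat" where
  "perm_charge u = word_maj (rev (perm_inverse u))"

text \<open>The positions (counted from 0) met when scanning leftwards cyclically, starting left of \<open>p\<close>.\<close>

definition cyclic_left :: "nat list \<Rightarrow> nat \<Rightarrow> nat list" where
  "cyclic_left w p = rev [0..<p] @ rev [Suc p..<length w]"

text \<open>
  Position of the letter \<open>i\<close> chosen for the first standard subword. Index 0 gives the position
  just past the right end, from which the leftward scan finds the rightmost 1.
  The search succeeds for all letters of a word whose content is a partition.
\<close>

primrec letter_pos :: "nat list \<Rightarrow> nat \<Rightarrow> nat" where
  "letter_pos w 0 = length w"
| "letter_pos w (Suc i) =
     the (find (\<lambda>q. w ! q = Suc i) (cyclic_left w (letter_pos w i)))"

definition chosen :: "nat list \<Rightarrow> nat set" where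
  "chosen w = letter_pos w ` {1..Max (set w)}"

lemma length_unchosen_less:
  assumes "1 \<in> set w"
  shows "length (nths w (- chosen w)) < length w"
proof -
  let ?P = "\<lambda>q. w ! q = Suc 0"
  obtain q where q: "q < length w" "w ! q = Suc 0"
    using assms by (auto simp: in_set_conv_nth)
  then have "find ?P (rev [0..<length w]) \<noteq> None"
    by (auto simp: find_None_iff)
  then obtain p where f: "find ?P (rev [0..<length w]) = Some p"
    by blast
  have p: "letter_pos w 1 = p" "p < length w"
    using f by (simp add: cyclic_left_def) (use f in \<open>auto simp: find_Some_iff rev_nth\<close>)
  have "1 \<le> Max (set w)"
    using assms by simp
  then have "p \<in> chosen w"
    unfolding chosen_def using p(1) by force
  then have "{i. i < length w \<and> i \<in> - chosen w} \<subset> {..<length w}"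
    using p(2) by auto
  then have "card {i. i < length w \<and> i \<in> - chosen w} < card {..<length w}"
    by (intro psubset_card_mono) auto
  then show ?thesis
    by (simp add: length_nths)
qed

text \<open>A word whose content is a partition contains no 1 iff it is empty.\<close>

function standard_subwords :: "nat list \<Rightarrow> nat list list" where
  "standard_subwords w =
     (if 1 \<in> set w then nths w (chosen w) # standard_subwords (nths w (- chosen w)) else [])"
  by auto
termination
  by (relation "measure length") (use length_unchosen_less in auto)

declare standard_subwords.simps [simp del]

definition charge :: "nat list \<Rightarrow> nat" where
  "charge w = sum_list (map perm_charge (standard_subwords w))"

end

theory Submission
  imports Defs
begin

text \<open>
  In a coinversion-free filling each entry of a row is found by scanning the values cyclically
  downwards from the entry to its left, and the charge algorithm scans the charge word in the same
  way. If the shape is a partition, the rows are exactly the standard subwords: every row is served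
  before the rows below it, and a descent of the row is a wrap-around of the scan.

  A general shape is bubble-sorted to a partition. If row \<open>i\<close> (entries \<open>x\<close>) is shorter than row
  \<open>i + 1\<close> (entries \<open>y\<close>), the two lengths are exchanged and the entries are redistributed column by
  column: the new long row \<open>X\<close> starts in the basement of \<open>x\<close> and always moves to whichever of
  \<open>x\<^sub>j, y\<^sub>j\<close> it meets first. The columns keep their sets of entries, so the charge word does not
  change. Lifting the paths to the universal cover of the circle of values shows that \<open>X\<close> stays less
  than one turn above \<open>y\<close>, and that \<open>X\<close> and \<open>Y\<close> together wind as often as \<open>x\<close> and \<open>y\<close>. The major
  index is a sum of winding numbers, so it does not change either.
\<close>

section \<open>Fillings in terms of cyclic scanning\<close>

text \<open>Scanning cyclically downwards from \<open>a\<close> (inclusive), \<open>b\<close> is met strictly before \<open>c\<close>.\<close>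

definition before :: "nat \<Rightarrow> nat \<Rightarrow> nat \<Rightarrow> bool" where
  "before a b c \<longleftrightarrow> (if b \<le> a then c < b \<or> a < c else a < c \<and> c < b)"

lemma before_neq: "before a b c \<Longrightarrow> c \<noteq> a \<and> c \<noteq> b"
  by (auto simp: before_def split: if_splits)

lemma before_total: "b \<noteq> c \<Longrightarrow> \<not> before a b c \<Longrightarrow> before a c b"
  by (auto simp: before_def split: if_splits)

text \<open>
  The last two clauses are the conditions on type A and type B triples; they already imply that the
  filling is non-attacking.
\<close>

definition good :: "nat \<Rightarrow> (nat \<Rightarrow> nat) \<Rightarrow> (nat \<Rightarrow> nat \<Rightarrow> nat) \<Rightarrow> bool" where
  "good n l F \<longleftrightarrow>
     (\<forall>r. 1 \<le> r \<and> r \<le> n \<longrightarrow> F r 0 = Suc n - r) \<and>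
     (\<forall>r j. 1 \<le> r \<and> r \<le> n \<and> j \<le> l r \<longrightarrow> F r j \<le> n) \<and>
     (\<forall>r k j. 1 \<le> r \<and> r < k \<and> k \<le> n \<and> l k \<le> l r \<and> j < l k \<longrightarrow>
        before (F r j) (F r (Suc j)) (F k (Suc j))) \<and>
     (\<forall>r k j. 1 \<le> k \<and> k < r \<and> r \<le> n \<and> l k < l r \<and> j \<le> l k \<longrightarrow>
        before (F r j) (F r (Suc j)) (F k j))"

section \<open>Winding numbers and the major index of one row\<close>

text \<open>Counts the wrap-arounds of a path that always moves cyclically downwards: a step to a
  larger value has passed the bottom of the circle.\<close>

primrec wind :: "(nat \<Rightarrow> nat) \<Rightarrow> nat \<Rightarrow> nat" where
  "wind f 0 = 0"
| "wind f (Suc j) = wind f j + (if f j < f (Suc j) then 1 else 0)"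

text \<open>The step from \<open>j\<close> to \<open>Suc j\<close> enters a box with leg
  \<open>m - Suc j\<close>, so \<open>m - j\<close> is its leg plus one.\<close>

definition row_maj :: "(nat \<Rightarrow> nat) \<Rightarrow> nat \<Rightarrow> nat" where
  "row_maj f m = (\<Sum>j<m. if f j < f (Suc j) then m - j else 0)"

lemma wind_eq_sum: "wind f m = (\<Sum>j<m. if f j < f (Suc j) then 1 else 0)"
  by (induction m) auto

text \<open>An ascent at step \<open>j\<close> is counted by the \<open>m - j\<close> winding
  numbers of the columns \<open>Suc j\<close> to \<open>m\<close>.\<close>

lemma row_maj_eq_sum_wind: "row_maj f m = (\<Sum>j<m. wind f (Suc j))"
proof (induction m)
  case 0
  then show ?case by (simp add: row_maj_def)
next
  case (Suc m)
  have "row_maj f (Suc m) = (\<Sum>j<Suc m. (if f j < f (Suc j) then m - j else 0) +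
          (if f j < f (Suc j) then 1 else 0))"
    unfolding row_maj_def by (rule sum.cong) auto
  also have "\<dots> = row_maj f m + wind f (Suc m)"
    by (simp only: sum.distrib wind_eq_sum) (simp add: row_maj_def)
  finally show ?case
    using Suc by simp
qed

section \<open>Exchanging the lengths of two adjacent rows\<close>

text \<open>Entries \<open>x\<close> of a row of length \<open>s\<close> and entries \<open>y\<close> of a longer row immediately below it.\<close>

locale row_pair =
  fixes x y :: "nat \<Rightarrow> nat" and s :: nat
  assumes y_before_x: "j \<le> s \<Longrightarrow> before (y j) (y (Suc j)) (x j)"
    and start: "y 0 < x 0"
begin

text \<open>Records whether the new long row sits at \<open>y\<close> instead of \<open>x\<close>;
  the conditional is its current entry, called \<open>X j\<close> below. After column
  \<open>s\<close> the row \<open>x\<close> has ended, so only \<open>y\<close> can be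
  followed.\<close>

primrec swapped :: "nat \<Rightarrow> bool" where
  "swapped 0 \<longleftrightarrow> False"
| "swapped (Suc j) \<longleftrightarrow> s \<le> j \<or> before (if swapped j then y j else x j) (y (Suc j)) (x (Suc j))"

definition X :: "nat \<Rightarrow> nat" where "X j = (if swapped j then y j else x j)"
definition Y :: "nat \<Rightarrow> nat" where "Y j = (if swapped j then x j else y j)"

lemma swapped_Suc: "swapped (Suc j) \<longleftrightarrow> s \<le> j \<or> before (X j) (y (Suc j)) (x (Suc j))"
  by (simp add: X_def)

declare swapped.simps(2) [simp del]

lemma X_late: "s < j \<Longrightarrow> X j = y j"
  by (cases j) (auto simp: X_def swapped_Suc)

lemma XY_set: "X j = x j \<and> Y j = y j \<or> X j = y j \<and> Y j = x j"
  by (auto simp: X_def Y_def)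

lemma xy_neq: "j \<le> s \<Longrightarrow> x j \<noteq> y j"
  using y_before_x[of j] before_neq by blast

text \<open>This is the type A condition for the new pair. Up to column \<open>s\<close> the two
  entries of a column differ, so one is met first, and \<open>X\<close> takes that one.\<close>

lemma X_before_Y:
  assumes "j < s"
  shows "before (X j) (X (Suc j)) (Y (Suc j))"
proof (cases "before (X j) (y (Suc j)) (x (Suc j))")
  case True
  then have "swapped (Suc j)" using swapped_Suc by blast
  with True show ?thesis by (simp only: X_def[of "Suc j"] Y_def[of "Suc j"] if_True)
next
  case False
  then have "\<not> swapped (Suc j)" using assms swapped_Suc by auto
  moreover have "before (X j) (x (Suc j)) (y (Suc j))"
    using False xy_neq[of "Suc j"] assms before_total[of "y (Suc j)" "x (Suc j)"] by auto
  ultimately show ?thesis by (simp only: X_def[of "Suc j"] Y_def[of "Suc j"] if_False)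
qed

text \<open>The one-step arguments below split into these four moves; in each, only the order of a
  few values is left to compare.\<close>

lemma step_cases:
  assumes "j < s"
  obtains (stay) "X j = x j" "Y j = y j" "X (Suc j) = x (Suc j)" "Y (Suc j) = y (Suc j)"
      "before (x j) (x (Suc j)) (y (Suc j))" "\<not> swapped j" "\<not> swapped (Suc j)"
  | (swap) "X j = x j" "Y j = y j" "X (Suc j) = y (Suc j)" "Y (Suc j) = x (Suc j)"
      "before (x j) (y (Suc j)) (x (Suc j))" "\<not> swapped j" "swapped (Suc j)"
  | (unswap) "X j = y j" "Y j = x j" "X (Suc j) = x (Suc j)" "Y (Suc j) = y (Suc j)"
      "before (y j) (x (Suc j)) (y (Suc j))" "swapped j" "\<not> swapped (Suc j)"
  | (stay_swapped) "X j = y j" "Y j = x j" "X (Suc j) = y (Suc j)" "Y (Suc j) = x (Suc j)"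
      "before (y j) (y (Suc j)) (x (Suc j))" "swapped j" "swapped (Suc j)"
proof -
  have XY: "X k = (if swapped k then y k else x k)" "Y k = (if swapped k then x k else y k)" for k
    by (auto simp: X_def Y_def)
  note b = X_before_Y[OF assms]
  show thesis
  proof (cases "swapped j"; cases "swapped (Suc j)")
    assume "swapped j" "swapped (Suc j)"
    with b show thesis by (intro stay_swapped) (simp_all add: XY)
  next
    assume "swapped j" "\<not> swapped (Suc j)"
    with b show thesis by (intro unswap) (simp_all add: XY)
  next
    assume "\<not> swapped j" "swapped (Suc j)"
    with b show thesis by (intro swap) (simp_all add: XY)
  next
    assume "\<not> swapped j" "\<not> swapped (Suc j)"
    with b show thesis by (intro stay) (simp_all add: XY)
  qed
qed

section \<open>Winding numbers of the two new rows\<close>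

text \<open>Exchanging the end points of two downward steps can change their total length only by
  whole turns; \<open>B\<close> and the order in which \<open>X\<close> meets the two entries
  exclude such a change.\<close>

lemma wind_sum:
  assumes "j \<le> s"
  shows "wind X j + wind Y j = wind x j + wind y j"
  using assms
proof (induction j)
  case 0
  then show ?case by simp
next
  case (Suc j)
  have B: "before (y j) (y (Suc j)) (x j)" using y_before_x[of j] Suc by simp
  have IH: "wind X j + wind Y j = wind x j + wind y j" using Suc by simp
  have "j < s" using Suc by simp
  then show ?case
    by (cases rule: step_cases; insert B IH; simp; auto simp: before_def split: if_splits)
qed

text \<open>
  The bracket says that the lift of \<open>X j\<close> is the lowest lift of its value that is not below the
  lift of \<open>y j\<close>.
\<close>

lemma wind_X:
  assumes "j \<le> s"
  shows "wind X j + (if X j < y j then 1 else 0) = wind y j"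
  using assms
proof (induction j)
  case 0
  then show ?case using start by (simp add: X_def)
next
  case (Suc j)
  have B: "before (y j) (y (Suc j)) (x j)" using y_before_x[of j] Suc by simp
  have IH: "wind X j + (if X j < y j then 1 else 0) = wind y j" using Suc by simp
  have "j < s" using Suc by simp
  then show ?case
    by (cases rule: step_cases; insert B IH; simp; auto simp: before_def split: if_splits)
qed

lemma wind_X_late: "s < j \<Longrightarrow> wind X j = wind y j"
proof (induction j)
  case 0
  then show ?case by simp
next
  case (Suc j)
  show ?case
  proof (cases "j = s")
    case True
    \<comment> \<open>Since \<open>y\<close> does not pass \<open>x s\<close> in this step, the
      ascent of \<open>X\<close> on joining \<open>y\<close>, if any, equals the bracket of
      \<open>wind_X\<close> plus the ascent of \<open>y\<close>.\<close>
    have "before (y s) (y (Suc s)) (x s)" using y_before_x[of s] by simp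
    moreover have "X (Suc s) = y (Suc s)" by (simp add: X_late)
    moreover have "X s = x s \<or> X s = y s" using XY_set by blast
    ultimately show ?thesis using wind_X[of s] True
      by (auto simp: before_def split: if_splits)
  next
    case False
    then show ?thesis using Suc X_late[of j] X_late[of "Suc j"] by simp
  qed
qed

text \<open>Columns up to \<open>s\<close> balance in sum by \<open>wind_sum\<close>, later ones
  term by term by \<open>wind_X_late\<close>.\<close>

lemma row_maj_XY:
  assumes "s < l"
  shows "row_maj X l + row_maj Y s = row_maj x s + row_maj y l"
proof -
  have split: "(\<Sum>j<l. f j) = (\<Sum>j<s. f j) + (\<Sum>j\<in>{s..<l}. f j)" for f :: "nat \<Rightarrow> nat"
    using assms sum.atLeastLessThan_concat[of 0 s l f] by (simp add: atLeast0LessThan)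
  have "(\<Sum>j\<in>{s..<l}. wind X (Suc j)) = (\<Sum>j\<in>{s..<l}. wind y (Suc j))"
    by (rule sum.cong) (auto simp: wind_X_late simp del: wind.simps)
  moreover have "(\<Sum>j<s. wind X (Suc j)) + (\<Sum>j<s. wind Y (Suc j)) =
      (\<Sum>j<s. wind x (Suc j)) + (\<Sum>j<s. wind y (Suc j))"
    unfolding sum.distrib[symmetric]
    by (rule sum.cong) (auto simp: wind_sum simp del: wind.simps)
  ultimately show ?thesis
    unfolding row_maj_eq_sum_wind split by simp
qed

section \<open>Comparison with a third row\<close>

text \<open>\<open>before a b c\<close> says that \<open>c\<close> is off the closed arc from
  \<open>a\<close> down to \<open>b\<close>, and the arcs of \<open>X\<close> and \<open>Y\<close>
  cover together what those of \<open>x\<close> and \<open>y\<close> cover. This serves third rows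
  short enough to supply \<open>c\<close> in their triples with both old rows.\<close>

lemma before_XY_if_before_xy:
  assumes "j < s" "before (x j) (x (Suc j)) c" "before (y j) (y (Suc j)) c"
  shows "before (X j) (X (Suc j)) c" "before (Y j) (Y (Suc j)) c"
proof -
  have B: "before (y j) (y (Suc j)) (x j)" using y_before_x[of j] assms by simp
  show "before (X j) (X (Suc j)) c"
    using assms(1) by (cases rule: step_cases; insert B assms(2,3); simp only:; auto simp: before_def split: if_splits)
  show "before (Y j) (Y (Suc j)) c"
    using assms(1) by (cases rule: step_cases; insert B assms(2,3); simp only:; auto simp: before_def split: if_splits)
qed

text \<open>
  A third row \<open>z\<close> below, with length in \<open>(s, l]\<close> where \<open>l\<close> is the length of \<open>y\<close>, may cross the row
  \<open>x\<close>, but the cyclic order \<open>x, y, z\<close> of the basement is restored whenever \<open>X\<close> follows \<open>x\<close>.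
  For a row above, with length in \<open>[s, l)\<close>, the same holds by \<open>order_above\<close>.
\<close>

lemma order_below:
  assumes zx: "\<And>j. j \<le> s \<Longrightarrow> before (z j) (z (Suc j)) (x j)"
    and yz: "\<And>j. j \<le> s \<Longrightarrow> before (y j) (y (Suc j)) (z (Suc j))"
    and z0: "before (x 0) (y 0) (z 0)"
  shows "j \<le> s \<Longrightarrow> \<not> swapped j \<Longrightarrow> before (x j) (y j) (z j)"
proof (induction j)
  case 0
  then show ?case using z0 by simp
next
  case (Suc j)
  have "j < s" using Suc by simp
  then show ?case
    by (cases rule: step_cases; insert Suc y_before_x[of j] zx[of j] yz[of j]; simp only:;
        auto simp: before_def split: if_splits)
qed

text \<open>The row \<open>z\<close> had type B triples with \<open>x\<close> and type A triples
  with \<open>y\<close>; now it needs them with \<open>Y\<close> and \<open>X\<close>. While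
  \<open>X\<close> follows \<open>x\<close>, \<open>order_below\<close> supplies the missing
  comparison.\<close>

lemma below_medium:
  assumes zx: "\<And>j. j \<le> s \<Longrightarrow> before (z j) (z (Suc j)) (x j)"
    and yz: "\<And>j. j \<le> s \<Longrightarrow> before (y j) (y (Suc j)) (z (Suc j))"
    and z0: "before (x 0) (y 0) (z 0)"
    and j: "j \<le> s"
  shows "before (X j) (X (Suc j)) (z (Suc j))" "before (z j) (z (Suc j)) (Y j)"
proof -
  note o = order_below[of z, OF zx yz z0 j]
  have facts: "before (y j) (y (Suc j)) (x j)" "before (z j) (z (Suc j)) (x j)"
    "before (y j) (y (Suc j)) (z (Suc j))"
    using y_before_x zx yz j by auto
  show "before (z j) (z (Suc j)) (Y j)"
    using o facts by (cases "swapped j") (auto simp: Y_def before_def split: if_splits)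
  show "before (X j) (X (Suc j)) (z (Suc j))"
  proof (cases "j = s")
    case True
    then have "X (Suc j) = y (Suc j)" by (simp add: X_late)
    then show ?thesis
      using o facts by (cases "swapped j") (auto simp: X_def[of j] before_def split: if_splits)
  next
    case False
    then have "j < s" using j by simp
    then show ?thesis
      by (cases rule: step_cases; insert o facts; simp only:; auto simp: before_def split: if_splits)
  qed
qed

lemma order_above:
  assumes zx: "\<And>j. j < s \<Longrightarrow> before (z j) (z (Suc j)) (x (Suc j))"
    and yz: "\<And>j. j \<le> s \<Longrightarrow> before (y j) (y (Suc j)) (z j)"
    and z0: "before (x 0) (y 0) (z 0)"
  shows "j \<le> s \<Longrightarrow> \<not> swapped j \<Longrightarrow> before (x j) (y j) (z j)"
proof (induction j)
  case 0
  then show ?case using z0 by simp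
next
  case (Suc j)
  have "j < s" using Suc by simp
  then show ?case
    by (cases rule: step_cases; insert Suc y_before_x[of j] zx[of j] yz[of j]; simp only:;
        auto simp: before_def split: if_splits)
qed

text \<open>For a row \<open>z\<close> above, the types are exchanged: B with \<open>X\<close>, A
  with \<open>Y\<close>. The comparison with \<open>X\<close> is needed up to \<open>j = s\<close>,
  that with \<open>Y\<close> only for \<open>j < s\<close>, hence two lemmas.\<close>

lemma above_medium_X:
  assumes zx: "\<And>j. j < s \<Longrightarrow> before (z j) (z (Suc j)) (x (Suc j))"
    and yz: "\<And>j. j \<le> s \<Longrightarrow> before (y j) (y (Suc j)) (z j)"
    and z0: "before (x 0) (y 0) (z 0)"
    and j: "j \<le> s"
  shows "before (X j) (X (Suc j)) (z j)"
proof -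
  note o = order_above[of z, OF zx yz z0 j]
  have facts: "before (y j) (y (Suc j)) (x j)" "before (y j) (y (Suc j)) (z j)"
    using y_before_x yz j by auto
  show ?thesis
  proof (cases "j = s")
    case True
    then have "X (Suc j) = y (Suc j)" by (simp add: X_late)
    then show ?thesis
      using o facts by (cases "swapped j") (auto simp: X_def[of j] before_def split: if_splits)
  next
    case False
    then have "j < s" using j by simp
    then show ?thesis
      by (cases rule: step_cases; insert o facts; simp only:; auto simp: before_def split: if_splits)
  qed
qed

lemma above_medium_Y:
  assumes zx: "\<And>j. j < s \<Longrightarrow> before (z j) (z (Suc j)) (x (Suc j))"
    and yz: "\<And>j. j \<le> s \<Longrightarrow> before (y j) (y (Suc j)) (z j)"
    and z0: "before (x 0) (y 0) (z 0)"
    and j: "j < s"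
  shows "before (z j) (z (Suc j)) (Y (Suc j))"
proof -
  have o: "\<not> swapped j \<Longrightarrow> before (x j) (y j) (z j)"
    using order_above[of z, OF zx yz z0] j by simp
  have facts: "before (y j) (y (Suc j)) (x j)" "before (y j) (y (Suc j)) (z j)"
    "before (z j) (z (Suc j)) (x (Suc j))"
    using y_before_x yz zx j by auto
  show ?thesis
    using j
    by (cases rule: step_cases; insert o facts; simp only:; auto simp: before_def split: if_splits)
qed

end

section \<open>One exchange of adjacent rows in a whole filling\<close>

lemma goodD:
  assumes "good n l F"
  shows "1 \<le> r \<Longrightarrow> r \<le> n \<Longrightarrow> F r 0 = Suc n - r"
    and "1 \<le> r \<Longrightarrow> r \<le> n \<Longrightarrow> j \<le> l r \<Longrightarrow> F r j \<le> n"
    and "1 \<le> r \<Longrightarrow> r < k \<Longrightarrow> k \<le> n \<Longrightarrow> l k \<le> l r \<Longrightarrow> j < l k \<Longrightarrow>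
      before (F r j) (F r (Suc j)) (F k (Suc j))"
    and "1 \<le> k \<Longrightarrow> k < r \<Longrightarrow> r \<le> n \<Longrightarrow> l k < l r \<Longrightarrow> j \<le> l k \<Longrightarrow>
      before (F r j) (F r (Suc j)) (F k j)"
  using assms unfolding good_def by blast+

text \<open>These are the columns of the two-line array. A set suffices, since the entries within a
  column of a good filling are distinct and the array is strictly sorted.\<close>

definition pairs :: "nat \<Rightarrow> (nat \<Rightarrow> nat) \<Rightarrow> (nat \<Rightarrow> nat \<Rightarrow> nat) \<Rightarrow> (nat \<times> nat) set" where
  "pairs n l F = {(F r j, j) | r j. 1 \<le> r \<and> r \<le> n \<and> 1 \<le> j \<and> j \<le> l r}"

text \<open>One step of the bubble sort. Triples with a third row are treated according to whether
  its length compares alike with both exchanged lengths or lies between them.\<close>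

lemma good_swap:
  assumes good: "good n l F" and i: "1 \<le> i" "i < n" "l i < l (Suc i)"
  obtains F' where "good n (l(i := l (Suc i), Suc i := l i)) F'"
    "pairs n (l(i := l (Suc i), Suc i := l i)) F' = pairs n l F"
    "(\<Sum>r = 1..n. row_maj (F' r) ((l(i := l (Suc i), Suc i := l i)) r)) =
     (\<Sum>r = 1..n. row_maj (F r) (l r))"
proof -
  let ?x = "F i" and ?y = "F (Suc i)" and ?s = "l i" and ?t = "l (Suc i)"
  let ?l = "l(i := l (Suc i), Suc i := l i)"
  interpret row_pair ?x ?y ?s
  proof
    show "before (?y j) (?y (Suc j)) (?x j)" if "j \<le> ?s" for j
      using goodD(4)[OF good] i that by simp
    show "?y 0 < ?x 0"
      using goodD(1)[OF good] i by simp
  qed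
  let ?F = "F(i := X, Suc i := Y)"
  have XY0: "X 0 = ?x 0" "Y 0 = ?y 0" by (auto simp: X_def Y_def)
  \<comment> \<open>The basement entries of rows \<open>i\<close> and \<open>Suc i\<close> are
    consecutive numbers, so no other one lies between them.\<close>
  have order0: "before (?x 0) (?y 0) (F z 0)" if "1 \<le> z" "z \<le> n" "z \<noteq> i" "z \<noteq> Suc i" for z
    using that goodD(1)[OF good] i by (auto simp: before_def)
  have A: "before (?F r j) (?F r (Suc j)) (?F k (Suc j))"
    if rk: "1 \<le> r" "r < k" "k \<le> n" and le: "?l k \<le> ?l r" and j: "j < ?l k" for r k j
  proof -
    consider "r = i" "k = Suc i" | "r = i" "k > Suc i" | "r = Suc i" "k > Suc i"
      | "r < i" "k = i" | "r < i" "k = Suc i" | "r \<notin> {i, Suc i}" "k \<notin> {i, Suc i}"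
      using rk by fastforce
    then show ?thesis
    proof cases
      case 1
      then show ?thesis using X_before_Y[of j] j by simp
    next
      case 2
      then have k: "k \<noteq> i" "k \<noteq> Suc i" by auto
      have lk: "l k \<le> ?t" "j < l k" using le j 2 k by auto
      have y: "before (?y a) (?y (Suc a)) (F k (Suc a))" if "a < l k" for a
        using goodD(3)[OF good, of "Suc i" k a] 2 rk lk that by simp
      have "before (X j) (X (Suc j)) (F k (Suc j))"
      \<comment> \<open>A row \<open>k\<close> not longer than \<open>x\<close> had type A triples
        with both old rows; a longer one had type B triples with \<open>x\<close>, which is the
        situation of \<open>below_medium\<close>.\<close>
      proof (cases "l k \<le> ?s")
        case True
        then show ?thesis
          using before_XY_if_before_xy(1)[of j "F k (Suc j)"] y[of j] lk goodD(3)[OF good, of i k j] 2 rk by simp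
      next
        case False
        show ?thesis
        proof (cases "j \<le> ?s")
          case True
          show ?thesis
          proof (rule below_medium(1)[where z = "F k"])
            show "before (F k a) (F k (Suc a)) (?x a)" if "a \<le> ?s" for a
              using goodD(4)[OF good, of i k a] 2 rk False that by simp
            show "before (?y a) (?y (Suc a)) (F k (Suc a))" if "a \<le> ?s" for a
              using y that False by simp
            show "before (?x 0) (?y 0) (F k 0)" using order0 k rk by simp
          qed fact
        next
          case False
          then show ?thesis using y[of j] lk X_late[of j] X_late[of "Suc j"] by simp
        qed
      qed
      then show ?thesis using 2 k by simp
    next
      case 3
      then have k: "k \<noteq> i" "k \<noteq> Suc i" by auto
      have lk: "l k \<le> ?s" "j < l k" using le j 3 k by auto
      then have "before (Y j) (Y (Suc j)) (F k (Suc j))"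
        using before_XY_if_before_xy(2)[of j "F k (Suc j)"] goodD(3)[OF good, of i k j]
          goodD(3)[OF good, of "Suc i" k j] 3 rk i by simp
      then show ?thesis using 3 k by simp
    next
      case 4
      then have lr: "?t \<le> l r" "j < ?t" using le j by auto
      \<comment> \<open>Here \<open>X\<close> enters through a single entry, which is one of the two
        old ones.\<close>
      have "before (F r j) (F r (Suc j)) (?y (Suc j))"
        using goodD(3)[OF good, of r "Suc i" j] lr 4 rk i by simp
      moreover have "before (F r j) (F r (Suc j)) (?x (Suc j))" if "j < ?s"
        using goodD(3)[OF good, of r i j] lr 4 rk i that by simp
      ultimately have "before (F r j) (F r (Suc j)) (X (Suc j))"
        using XY_set[of "Suc j"] X_late[of "Suc j"] by (cases "j < ?s") auto
      then show ?thesis using 4 by simp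
    next
      case 5
      then have lr: "?s \<le> l r" "j < ?s" using le j by auto
      have x: "before (F r a) (F r (Suc a)) (?x (Suc a))" if "a < ?s" for a
        using goodD(3)[OF good, of r i a] lr 5 rk i that by simp
      have "before (F r j) (F r (Suc j)) (Y (Suc j))"
      proof (cases "?t \<le> l r")
        case True
        then have "before (F r j) (F r (Suc j)) (?y (Suc j))"
          using goodD(3)[OF good, of r "Suc i" j] lr 5 rk i by simp
        then show ?thesis using x[of j] lr XY_set[of "Suc j"] by auto
      next
        case False
        show ?thesis
        proof (rule above_medium_Y[where z = "F r"])
          show "before (?y a) (?y (Suc a)) (F r a)" if "a \<le> ?s" for a
            using goodD(4)[OF good, of r "Suc i" a] lr 5 rk i that False by simp
          show "before (?x 0) (?y 0) (F r 0)" using order0 5 rk by simp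
        qed (use x lr in auto)
      qed
      then show ?thesis using 5 by simp
    next
      case 6
      then show ?thesis using goodD(3)[OF good, of r k j] rk le j by simp
    qed
  qed
  have B: "before (?F r j) (?F r (Suc j)) (?F k j)"
    if rk: "1 \<le> k" "k < r" "r \<le> n" and le: "?l k < ?l r" and j: "j \<le> ?l k" for r k j
  proof -
    consider "k = i" "r = Suc i" | "k = i" "r > Suc i" | "k = Suc i" "r > Suc i"
      | "k < i" "r = i" | "k < i" "r = Suc i" | "r \<notin> {i, Suc i}" "k \<notin> {i, Suc i}"
      using rk by fastforce
    then show ?thesis
    proof cases
      case 1
      then show ?thesis using le i by simp
    next
      case 2
      then have lr: "?t < l r" "j \<le> ?t" using le j by auto
      have "before (F r j) (F r (Suc j)) (?y j)"
        using goodD(4)[OF good, of "Suc i" r j] lr 2 rk i by simp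
      moreover have "before (F r j) (F r (Suc j)) (?x j)" if "j \<le> ?s"
        using goodD(4)[OF good, of i r j] lr 2 rk i that by simp
      ultimately have "before (F r j) (F r (Suc j)) (X j)"
        using XY_set[of j] X_late[of j] by (cases "j \<le> ?s") auto
      then show ?thesis using 2 by simp
    next
      case 3
      then have lr: "?s < l r" "j \<le> ?s" using le j by auto
      have x: "before (F r a) (F r (Suc a)) (?x a)" if "a \<le> ?s" for a
        using goodD(4)[OF good, of i r a] lr 3 rk i that by simp
      have "before (F r j) (F r (Suc j)) (Y j)"
      proof (cases "?t < l r")
        case True
        then have "before (F r j) (F r (Suc j)) (?y j)"
          using goodD(4)[OF good, of "Suc i" r j] lr 3 rk i by simp
        then show ?thesis using x[of j] lr XY_set[of j] by auto
      next
        case False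
        show ?thesis
        proof (rule below_medium(2)[where z = "F r"])
          show "before (?y a) (?y (Suc a)) (F r (Suc a))" if "a \<le> ?s" for a
            using goodD(3)[OF good, of "Suc i" r a] lr 3 rk i that False by simp
          show "before (?x 0) (?y 0) (F r 0)" using order0 3 rk by simp
        qed (use x lr in auto)
      qed
      then show ?thesis using 3 by simp
    next
      case 4
      then have lk: "l k < ?t" "j \<le> l k" using le j by auto
      have y: "before (?y a) (?y (Suc a)) (F k a)" if "a \<le> l k" for a
        using goodD(4)[OF good, of k "Suc i" a] 4 rk i lk that by simp
      have "before (X j) (X (Suc j)) (F k j)"
      proof (cases "l k < ?s")
        case True
        then show ?thesis
          using before_XY_if_before_xy(1)[of j "F k j"] y[of j] lk goodD(4)[OF good, of k i j] 4 rk by simp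
      next
        case False
        show ?thesis
        proof (cases "j \<le> ?s")
          case True
          show ?thesis
          proof (rule above_medium_X[where z = "F k"])
            show "before (F k a) (F k (Suc a)) (?x (Suc a))" if "a < ?s" for a
              using goodD(3)[OF good, of k i a] 4 rk False that by simp
            show "before (?y a) (?y (Suc a)) (F k a)" if "a \<le> ?s" for a
              using y that False by simp
            show "before (?x 0) (?y 0) (F k 0)" using order0 4 rk by simp
          qed fact
        next
          case False
          then show ?thesis using y[of j] lk X_late[of j] X_late[of "Suc j"] by simp
        qed
      qed
      then show ?thesis using 4 by simp
    next
      case 5
      then have lk: "l k < ?s" "j \<le> l k" using le j by auto
      then have "before (Y j) (Y (Suc j)) (F k j)"
        using before_XY_if_before_xy(2)[of j "F k j"] goodD(4)[OF good, of k i j]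
          goodD(4)[OF good, of k "Suc i" j] 5 rk i by simp
      then show ?thesis using 5 by simp
    next
      case 6
      then show ?thesis using goodD(4)[OF good, of k r j] rk le j by simp
    qed
  qed
  have bound: "?F r j \<le> n" if "1 \<le> r" "r \<le> n" "j \<le> ?l r" for r j
  proof -
    have "?x j \<le> n" if "j \<le> ?s" using goodD(2)[OF good, of i j] i that by simp
    moreover have "?y j \<le> n" if "j \<le> ?t" using goodD(2)[OF good, of "Suc i" j] i that by simp
    moreover have "X j = ?y j \<or> j \<le> ?s \<and> X j = ?x j"
      using X_late[of j] XY_set[of j] by (cases "j \<le> ?s") auto
    ultimately show ?thesis
      using that i goodD(2)[OF good, of r j] XY_set[of j] by (cases "r = i"; cases "r = Suc i") auto
  qed
  have "good n ?l ?F"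
    unfolding good_def
  proof (intro conjI allI impI; elim conjE)
    show "?F r 0 = Suc n - r" if "1 \<le> r" "r \<le> n" for r
      using that goodD(1)[OF good, of r] XY0 by auto
  qed (rule bound A B; assumption)+
  moreover have "pairs n ?l ?F = pairs n l F"
  proof -
    have split: "pairs n m G = {(G r j, j) | r j. r \<in> {1..n} - {i, Suc i} \<and> 1 \<le> j \<and> j \<le> m r} \<union>
      ({(G i j, j) | j. 1 \<le> j \<and> j \<le> m i} \<union> {(G (Suc i) j, j) | j. 1 \<le> j \<and> j \<le> m (Suc i)})" for m G
      using i unfolding pairs_def by fastforce
    \<comment> \<open>Columns up to \<open>s\<close> keep both entries; later ones have only that of
      \<open>y\<close>, which \<open>X\<close> follows there.\<close>
    have "{(X j, j) | j. 1 \<le> j \<and> j \<le> ?t} \<union> {(Y j, j) | j. 1 \<le> j \<and> j \<le> ?s} =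
      {(?x j, j) | j. 1 \<le> j \<and> j \<le> ?s} \<union> {(?y j, j) | j. 1 \<le> j \<and> j \<le> ?t}" (is "?L = ?R")
    proof -
      have "(v, j) \<in> ?L \<longleftrightarrow> (v, j) \<in> ?R" for v j
        using XY_set[of j] X_late[of j] i by (cases "j \<le> ?s") auto
      then show ?thesis by auto
    qed
    then show ?thesis
      unfolding split by (auto simp del: Un_iff)
  qed
  moreover have "(\<Sum>r = 1..n. row_maj (?F r) (?l r)) = (\<Sum>r = 1..n. row_maj (F r) (l r))"
  proof -
    have split: "(\<Sum>r = 1..n. g r) = g i + g (Suc i) + (\<Sum>r\<in>{1..n} - {i, Suc i}. g r)"
      for g :: "nat \<Rightarrow> nat"
      using i by (subst sum.subset_diff[of "{i, Suc i}"]) auto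
    have "(\<Sum>r\<in>{1..n} - {i, Suc i}. row_maj (?F r) (?l r)) =
        (\<Sum>r\<in>{1..n} - {i, Suc i}. row_maj (F r) (l r))"
      by (rule sum.cong) auto
    then show ?thesis
      unfolding split using row_maj_XY[of ?t] i by simp
  qed
  ultimately show thesis by (rule that)
qed

section \<open>Charge of a partition-shaped filling\<close>

definition arr_less :: "nat \<times> nat \<Rightarrow> nat \<times> nat \<Rightarrow> bool" where
  "arr_less p q \<longleftrightarrow> fst p < fst q \<or> fst p = fst q \<and> snd q < snd p"

text \<open>Turns comparisons of positions in the charge word into comparisons of entries, so that
  scanning positions becomes scanning values.\<close>

lemma nth_less_iff:
  assumes "sorted_wrt arr_less xs" "a < length xs" "b < length xs"
  shows "a < b \<longleftrightarrow> arr_less (xs ! a) (xs ! b)"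
proof
  assume "a < b"
  then show "arr_less (xs ! a) (xs ! b)"
    using assms by (simp add: sorted_wrt_nth_less)
next
  assume l: "arr_less (xs ! a) (xs ! b)"
  show "a < b"
  proof (rule ccontr)
    assume "\<not> a < b"
    then consider "a = b" | "b < a" by linarith
    then have "a = b \<or> arr_less (xs ! b) (xs ! a)"
      using assms by cases (simp_all add: sorted_wrt_nth_less)
    then show False using l by (auto simp: arr_less_def)
  qed
qed

lemma distinct_if_sorted_arr_less: "sorted_wrt arr_less xs \<Longrightarrow> distinct xs"
  by (induction xs) (auto simp: arr_less_def)

lemma nths_eq_filter:
  "(\<And>i. i < length xs \<Longrightarrow> i \<in> A \<longleftrightarrow> P (xs ! i)) \<Longrightarrow> nths xs A = filter P xs"
proof (induction xs arbitrary: A)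
  case Nil
  then show ?case by simp
next
  case (Cons x xs)
  have "0 \<in> A \<longleftrightarrow> P x" using Cons.prems[of 0] by simp
  moreover have "nths xs {i. Suc i \<in> A} = filter P xs"
    using Cons.prems[of "Suc i" for i] by (intro Cons.IH) auto
  ultimately show ?case by (simp add: nths_Cons)
qed

lemma find_append: "find P (xs @ ys) = (case find P xs of None \<Rightarrow> find P ys | Some z \<Rightarrow> Some z)"
  by (induction xs) auto

lemma find_rev_upt:
  "a \<le> q \<Longrightarrow> q < b \<Longrightarrow> P q \<Longrightarrow> (\<And>q'. q < q' \<Longrightarrow> q' < b \<Longrightarrow> \<not> P q') \<Longrightarrow>
    find P (rev [a..<b]) = Some q"
proof (induction b)
  case 0
  then show ?case by simp
next
  case (Suc b)
  then show ?case by (cases "q = b") auto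
qed

text \<open>Here \<open>before\<close> is applied to positions. Its scan includes the start while
  \<open>cyclic_left\<close> omits it; \<open>letter_pos w i \<noteq> q\<close> removes the
  difference. The start may be \<open>length w\<close>, as for the letter 1.\<close>

lemma letter_pos_SucI:
  assumes q: "q < length w" "w ! q = Suc i"
    and p: "letter_pos w i \<le> length w" "letter_pos w i \<noteq> q"
    and first: "\<And>q'. q' < length w \<Longrightarrow> w ! q' = Suc i \<Longrightarrow> q' \<noteq> q \<Longrightarrow> before (letter_pos w i) q q'"
  shows "letter_pos w (Suc i) = q"
proof -
  let ?p = "letter_pos w i" and ?P = "\<lambda>q. w ! q = Suc i"
  have "find ?P (cyclic_left w ?p) = Some q"
  proof (cases "q < ?p")
    case True
    have "\<not> ?P q'" if "q < q'" "q' < ?p" for q'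
      using first[of q'] that p True by (auto simp: before_def split: if_splits)
    then have "find ?P (rev [0..<?p]) = Some q"
      using True q by (intro find_rev_upt) auto
    then show ?thesis by (simp add: cyclic_left_def find_append)
  next
    case False
    then have less: "?p < q" using p by simp
    have no: "\<not> ?P q'" if "q' < ?p \<or> q < q'" "q' < length w" for q'
      using first[of q'] that less by (auto simp: before_def split: if_splits)
    have "find ?P (rev [0..<?p]) = None"
      using no p by (auto simp: find_None_iff)
    moreover have "find ?P (rev [Suc ?p..<length w]) = Some q"
      using less q no by (intro find_rev_upt) auto
    ultimately show ?thesis by (simp add: cyclic_left_def find_append)
  qed
  then show ?thesis by simp
qed

lemma length_takeWhile_neq_less: "j \<in> set xs \<Longrightarrow> length (takeWhile (\<lambda>x. x \<noteq> j) xs) < length xs"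
  by (induction xs) auto

text \<open>Letter \<open>Suc j\<close> stands to the right of letter \<open>j\<close> iff
  \<open>v j < v (Suc j)\<close>, since equal entries list the larger column first. In the reversed
  inverse this is a descent at index \<open>m - j\<close>.\<close>

lemma perm_charge_row:
  assumes B: "sorted_wrt arr_less B" and set_B: "set B = (\<lambda>j. (v j, j)) ` {1..m}"
  shows "perm_charge (map snd B) = (\<Sum>j = 1..<m. if v j < v (Suc j) then m - j else 0)"
proof -
  let ?u = "map snd B"
  define pos where "pos j = length (takeWhile (\<lambda>x. x \<noteq> j) ?u)" for j
  have "card (set B) = m"
    unfolding set_B by (subst card_image) (auto simp: inj_on_def)
  then have len: "length B = m"
    using distinct_card[OF distinct_if_sorted_arr_less[OF B]] by simp
  have pos: "pos j < length B \<and> B ! pos j = (v j, j)" if "j \<in> {1..m}" for j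
  proof -
    have "j \<in> set ?u" using that set_B by force
    then have lt: "pos j < length ?u"
      unfolding pos_def by (rule length_takeWhile_neq_less)
    then have "?u ! pos j = j"
      using nth_length_takeWhile[of "\<lambda>x. x \<noteq> j" ?u] unfolding pos_def by simp
    moreover have "B ! pos j \<in> set B" using lt by simp
    ultimately show ?thesis using lt set_B by auto
  qed
  have pos_less: "pos j < pos (Suc j) \<longleftrightarrow> v j < v (Suc j)" if "1 \<le> j" "j < m" for j
    using pos[of j] pos[of "Suc j"] nth_less_iff[OF B, of "pos j" "pos (Suc j)"] that
    by (auto simp: arr_less_def)
  let ?L = "perm_inverse ?u"
  have lenL: "length ?L = m" by (simp add: perm_inverse_def len)
  have L: "?L ! a = Suc (pos (Suc a))" if "a < m" for a
    using that unfolding perm_inverse_def pos_def by (simp add: len del: upt_Suc)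
  have "{i. 1 \<le> i \<and> i < length (rev ?L) \<and> rev ?L ! (i - 1) > rev ?L ! i} =
      {i. 1 \<le> i \<and> i < m \<and> v (m - i) < v (Suc (m - i))}"
  proof (rule Collect_cong)
    fix i
    have "rev ?L ! (i - 1) > rev ?L ! i \<longleftrightarrow> v (m - i) < v (Suc (m - i))" if "1 \<le> i" "i < m"
    proof -
      have "rev ?L ! (i - 1) = Suc (pos (Suc (m - i)))" "rev ?L ! i = Suc (pos (m - i))"
        using that lenL by (simp_all add: rev_nth L Suc_diff_Suc)
      then show ?thesis using pos_less[of "m - i"] that by simp
    qed
    then show "(1 \<le> i \<and> i < length (rev ?L) \<and> rev ?L ! (i - 1) > rev ?L ! i) =
      (1 \<le> i \<and> i < m \<and> v (m - i) < v (Suc (m - i)))"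
      using lenL by auto
  qed
  then have "perm_charge ?u = \<Sum>{i. 1 \<le> i \<and> i < m \<and> v (m - i) < v (Suc (m - i))}"
    by (simp add: perm_charge_def word_maj_def)
  also have "\<dots> = (\<Sum>j | 1 \<le> j \<and> j < m \<and> v j < v (Suc j). m - j)"
    by (rule sum.reindex_bij_witness[of _ "\<lambda>j. m - j" "\<lambda>j. m - j"]) auto
  also have "\<dots> = (\<Sum>j = 1..<m. if v j < v (Suc j) then m - j else 0)"
    by (subst sum.inter_filter[symmetric]) (auto intro!: sum.cong)
  finally show ?thesis .
qed

text \<open>One round of the charge algorithm: the assumptions make the scan pick the entries of
  \<open>v\<close> in turn, so the first standard subword is this row and the remaining array is the
  filtered one.\<close>

lemma charge_row:
  assumes arr: "sorted_wrt arr_less arr" and m: "1 \<le> m"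
    and row: "\<And>j. 1 \<le> j \<Longrightarrow> j \<le> m \<Longrightarrow> (v j, j) \<in> set arr"
    and cols: "\<And>e j. (e, j) \<in> set arr \<Longrightarrow> 1 \<le> j \<and> j \<le> m"
    and first: "\<And>e. (e, 1) \<in> set arr \<Longrightarrow> e \<le> v 1"
    and "next": "\<And>j c. 1 \<le> j \<Longrightarrow> j < m \<Longrightarrow> (c, Suc j) \<in> set arr \<Longrightarrow> c \<noteq> v (Suc j) \<Longrightarrow>
      before (v j) (v (Suc j)) c"
  shows "charge (map snd arr) = (\<Sum>j = 1..<m. if v j < v (Suc j) then m - j else 0) +
    charge (map snd (filter (\<lambda>p. p \<notin> (\<lambda>j. (v j, j)) ` {1..m}) arr))"
proof -
  let ?w = "map snd arr" and ?R = "(\<lambda>j. (v j, j)) ` {1..m}"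
  obtain pos where pos: "\<And>j. 1 \<le> j \<Longrightarrow> j \<le> m \<Longrightarrow> pos j < length arr \<and> arr ! pos j = (v j, j)"
    using row unfolding in_set_conv_nth by metis
  note less = nth_less_iff[OF arr]
  have letter: "letter_pos ?w j = pos j" if "1 \<le> j" "j \<le> m" for j
    using that
  proof (induction j rule: dec_induct)
    case base
    have p1: "pos 1 < length arr" "arr ! pos 1 = (v 1, 1)" using pos m by auto
    \<comment> \<open>The scan starts past the right end, so the 1 with the largest entry is
      chosen.\<close>
    have "letter_pos ?w (Suc 0) = pos 1"
    proof (rule letter_pos_SucI)
      fix q' assume q': "q' < length ?w" "?w ! q' = Suc 0" "q' \<noteq> pos 1"
      then obtain e where e: "arr ! q' = (e, 1)" by (cases "arr ! q'") auto
      then have "e \<le> v 1" using first q' by (metis length_map nth_mem)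
      then have "\<not> pos 1 < q'" using less[of "pos 1" q'] p1 e q' by (auto simp: arr_less_def)
      then show "before (letter_pos ?w 0) (pos 1) q'"
        using p1 q' by (auto simp: before_def)
    qed (use p1 in auto)
    then show ?case by simp
  next
    case (step j)
    have pj: "pos j < length arr" "arr ! pos j = (v j, j)" using pos step by auto
    have ps: "pos (Suc j) < length arr" "arr ! pos (Suc j) = (v (Suc j), Suc j)" using pos step by auto
    have lp: "letter_pos ?w j = pos j" using step by simp
    show ?case
    proof (rule letter_pos_SucI)
      fix q' assume q': "q' < length ?w" "?w ! q' = Suc j" "q' \<noteq> pos (Suc j)"
      then obtain c where c: "arr ! q' = (c, Suc j)" by (cases "arr ! q'") auto
      have "c \<noteq> v (Suc j)"
        using distinct_if_sorted_arr_less[OF arr] nth_eq_iff_index_eq q' c ps by fastforce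
      then have b: "before (v j) (v (Suc j)) c"
        using "next"[of j c] step q' c by (metis Suc_le_eq length_map nth_mem)
      \<comment> \<open>An entry of column \<open>Suc j\<close> equal to \<open>v j\<close> stands
        to the left of \<open>pos j\<close>, in accordance with the inclusive start of
        \<open>before\<close>.\<close>
      have "pos j < pos (Suc j) \<longleftrightarrow> v j < v (Suc j)" "pos j < q' \<longleftrightarrow> v j < c"
        "q' < pos (Suc j) \<longleftrightarrow> c < v (Suc j)"
        using less[of "pos j" "pos (Suc j)"] less[of "pos j" q'] less[of q' "pos (Suc j)"] pj ps c q'
        by (auto simp: arr_less_def)
      then have "before (pos j) (pos (Suc j)) q'"
        using b unfolding before_def by (auto simp: not_le[symmetric] split: if_splits)
      then show "before (letter_pos ?w j) (pos (Suc j)) q'" using lp by simp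
    next
      show "letter_pos ?w j \<noteq> pos (Suc j)" using lp pj ps by auto
    qed (use ps pj lp in auto)
  qed
  have one: "1 \<in> set ?w" using row[of 1] m by force
  have "Max (set ?w) = m"
  proof (rule Max_eqI)
    show "y \<le> m" if "y \<in> set ?w" for y using that cols by auto
    show "m \<in> set ?w" using row[of m] m by force
  qed simp
  then have chosen_eq: "chosen ?w = pos ` {1..m}"
    unfolding chosen_def using letter by (intro image_cong) auto
  have chosen: "i \<in> chosen ?w \<longleftrightarrow> arr ! i \<in> ?R" if i: "i < length arr" for i
  proof -
    have "arr ! i = (v j, j) \<longleftrightarrow> i = pos j" if "j \<in> {1..m}" for j
      using pos[of j] that i
        nth_eq_iff_index_eq[OF distinct_if_sorted_arr_less[OF arr] i, of "pos j"] by simp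
    then show ?thesis
      unfolding chosen_eq image_iff by blast
  qed
  have "nths arr (chosen ?w) = filter (\<lambda>p. p \<in> ?R) arr"
    "nths arr (- chosen ?w) = filter (\<lambda>p. p \<notin> ?R) arr"
    using chosen by (auto intro!: nths_eq_filter)
  then have "standard_subwords ?w = map snd (filter (\<lambda>p. p \<in> ?R) arr) #
      standard_subwords (map snd (filter (\<lambda>p. p \<notin> ?R) arr))"
    using one by (subst standard_subwords.simps) (simp add: nths_map)
  moreover have "perm_charge (map snd (filter (\<lambda>p. p \<in> ?R) arr)) =
      (\<Sum>j = 1..<m. if v j < v (Suc j) then m - j else 0)"
    using row by (intro perm_charge_row sorted_wrt_filter arr) auto
  ultimately show ?thesis by (simp add: charge_def)
qed

text \<open>Charge does not see the basement, so descents in column 1 have to be excluded. Such a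
  descent would repeat the basement entry of a higher row, in attacking position.\<close>

lemma first_column_no_descent:
  assumes good: "good n l F" and r: "1 \<le> r" "r \<le> n" "1 \<le> l r"
  shows "F r 1 \<le> F r 0"
proof (rule ccontr)
  assume gt: "\<not> F r 1 \<le> F r 0"
  have le: "F r 1 \<le> n" using goodD(2)[OF good] r by simp
  have r0: "F r 0 = Suc n - r" using goodD(1)[OF good] r by simp
  \<comment> \<open>The row with basement entry \<open>F r 1\<close>; it lies above row
    \<open>r\<close>, because basement entries decrease downwards.\<close>
  define k where "k = Suc n - F r 1"
  have k: "1 \<le> k" "k < r" using gt le r0 r by (auto simp: k_def)
  then have k0: "F k 0 = F r 1" using goodD(1)[OF good, of k] r le by (simp add: k_def)
  show False
  proof (cases "l r \<le> l k")
    case True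
    then show False using goodD(3)[OF good, of k r 0] k r k0 before_neq by fastforce
  next
    case False
    then show False using goodD(4)[OF good, of k r 0] k r k0 before_neq by fastforce
  qed
qed

text \<open>Row \<open>i\<close> is a longest remaining row and forms type A triples with all rows
  below it, so one round of the algorithm extracts it and leaves the array of the rows from
  \<open>Suc i\<close> on.\<close>

lemma charge_partition:
  assumes good: "good n l F" and anti: "\<And>r k. 1 \<le> r \<Longrightarrow> r \<le> k \<Longrightarrow> k \<le> n \<Longrightarrow> l k \<le> l r"
  shows "1 \<le> i \<Longrightarrow> sorted_wrt arr_less arr \<Longrightarrow>
    set arr = {(F r j, j) | r j. i \<le> r \<and> r \<le> n \<and> 1 \<le> j \<and> j \<le> l r} \<Longrightarrow>
    charge (map snd arr) = (\<Sum>r = i..n. row_maj (F r) (l r))"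
proof (induction "Suc n - i" arbitrary: i arr)
  case 0
  then have "arr = []" by (auto simp flip: set_empty)
  moreover have "i > n" using 0 by simp
  ultimately show ?case by (simp add: charge_def standard_subwords.simps)
next
  case (Suc d)
  note arr = Suc.prems(2) and set = Suc.prems(3)
  have i: "1 \<le> i" "i \<le> n" using Suc by auto
  show ?case
  proof (cases "l i = 0")
    case True
    then have z: "l r = 0" if "i \<le> r" "r \<le> n" for r using anti[of i r] that i by simp
    then have "set arr = {}" unfolding set by fastforce
    moreover have "(\<Sum>r = i..n. row_maj (F r) (l r)) = 0"
      using z by (simp add: row_maj_def)
    ultimately show ?thesis by (simp add: charge_def standard_subwords.simps)
  next
    case False
    let ?m = "l i" and ?R = "(\<lambda>j. (F i j, j)) ` {1..l i}"
    have A: "before (F i j) (F i (Suc j)) (F r (Suc j))" if "i < r" "r \<le> n" "j < l r" for r j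
      using goodD(3)[OF good, of i r j] anti[of i r] i that by simp
    have "charge (map snd arr) = (\<Sum>j = 1..<?m. if F i j < F i (Suc j) then ?m - j else 0) +
        charge (map snd (filter (\<lambda>p. p \<notin> ?R) arr))"
    proof (rule charge_row[OF arr])
      show "1 \<le> ?m" using False by simp
      show "(F i j, j) \<in> set arr" if "1 \<le> j" "j \<le> ?m" for j
        using that i unfolding set by blast
      show "1 \<le> j \<and> j \<le> ?m" if "(e, j) \<in> set arr" for e j
        using that anti[of i] i unfolding set by fastforce
      show "e \<le> F i 1" if e: "(e, 1) \<in> set arr" for e
      proof -
        obtain r where r: "i \<le> r" "r \<le> n" "1 \<le> l r" "e = F r 1" using e unfolding set by auto
        show ?thesis
        proof (cases "r = i")
          case ne: False
          \<comment> \<open>As \<open>F r 1 \<le> F r 0 < F i 0\<close>, the entry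
            \<open>F r 1\<close> is not met after a wrap-around, so it lies below
            \<open>F i 1\<close>.\<close>
          have "before (F i 0) (F i 1) (F r 1)" using A[of r 0] r ne by simp
          moreover have "F i 1 \<le> F i 0" "F r 1 \<le> F r 0"
            using first_column_no_descent[OF good] r i False by auto
          moreover have "F r 0 < F i 0" using goodD(1)[OF good] r i ne by simp
          ultimately show ?thesis using r(4) by (simp add: before_def)
        qed (use r in simp)
      qed
      show "before (F i j) (F i (Suc j)) c"
        if c: "1 \<le> j" "j < ?m" "(c, Suc j) \<in> set arr" "c \<noteq> F i (Suc j)" for j c
      proof -
        obtain r where r: "i \<le> r" "r \<le> n" "Suc j \<le> l r" "c = F r (Suc j)"
          using c unfolding set by auto
        then have "r \<noteq> i" using c by auto
        then show ?thesis using A[of r j] r by simp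
      qed
    qed
    moreover have "charge (map snd (filter (\<lambda>p. p \<notin> ?R) arr)) = (\<Sum>r = Suc i..n. row_maj (F r) (l r))"
    proof (rule Suc.hyps)
      show "set (filter (\<lambda>p. p \<notin> ?R) arr) =
        {(F r j, j) | r j. Suc i \<le> r \<and> r \<le> n \<and> 1 \<le> j \<and> j \<le> l r}" (is "?L = ?S")
      proof -
        \<comment> \<open>Entries in a column are distinct, so deleting row \<open>i\<close> as a
          set of pairs takes nothing from the rows below.\<close>
        have notin: "(F r j, j) \<notin> ?R" if "Suc i \<le> r" "r \<le> n" "1 \<le> j" "j \<le> l r" for r j
          using A[of r "j - 1"] that before_neq[of "F i (j - 1)" "F i j" "F r j"] by auto
        show ?thesis
        proof (intro set_eqI iffI)
          fix p assume "p \<in> ?L"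
          then obtain r j where p: "p = (F r j, j)" "i \<le> r" "r \<le> n" "1 \<le> j" "j \<le> l r" "p \<notin> ?R"
            unfolding set_filter set by blast
          moreover have "r \<noteq> i" using p by auto
          ultimately have "Suc i \<le> r" by simp
          with p show "p \<in> ?S" by blast
        next
          fix p assume "p \<in> ?S"
          then obtain r j where p: "p = (F r j, j)" "Suc i \<le> r" "r \<le> n" "1 \<le> j" "j \<le> l r"
            by blast
          then have "i \<le> r" by simp
          then have "p \<in> set arr" unfolding set using p by blast
          then show "p \<in> ?L" using notin[of r j] p by simp
        qed
      qed
    qed (use Suc.hyps Suc.prems arr sorted_wrt_filter in auto)
    moreover have "row_maj (F i) ?m = (\<Sum>j = 1..<?m. if F i j < F i (Suc j) then ?m - j else 0)"
    proof -
      have "\<not> F i 0 < F i 1" using first_column_no_descent[OF good, of i] i False by simp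
      then show ?thesis
        using False unfolding row_maj_def atLeast0LessThan[symmetric]
        by (subst sum.atLeast_Suc_lessThan) auto
    qed
    moreover have "(\<Sum>r = i..n. row_maj (F r) (l r)) =
        row_maj (F i) ?m + (\<Sum>r = Suc i..n. row_maj (F r) (l r))"
      using i by (simp add: sum.atLeast_Suc_atMost)
    ultimately show ?thesis by simp
  qed
qed

section \<open>Reduction to partition shapes\<close>

text \<open>The array stays fixed during the bubble sort, while the weight
  \<open>\<Sum>r = 1..n. r * l r\<close> drops whenever a longer row moves up.\<close>

lemma charge_good:
  "good n l F \<Longrightarrow> sorted_wrt arr_less arr \<Longrightarrow> set arr = pairs n l F \<Longrightarrow>
    charge (map snd arr) = (\<Sum>r = 1..n. row_maj (F r) (l r))"
proof (induction "\<Sum>r = 1..n. r * l r" arbitrary: l F rule: less_induct)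
  case less
  show ?case
  proof (cases "\<exists>i. 1 \<le> i \<and> i < n \<and> l i < l (Suc i)")
    case True
    then obtain i where i: "1 \<le> i" "i < n" "l i < l (Suc i)" by blast
    let ?l = "l(i := l (Suc i), Suc i := l i)"
    obtain F' where F': "good n ?l F'" "pairs n ?l F' = pairs n l F"
      "(\<Sum>r = 1..n. row_maj (F' r) (?l r)) = (\<Sum>r = 1..n. row_maj (F r) (l r))"
      using good_swap[OF less.prems(1) i] by blast
    have split: "(\<Sum>r = 1..n. g r) = g i + g (Suc i) + (\<Sum>r\<in>{1..n} - {i, Suc i}. g r)"
      for g :: "nat \<Rightarrow> nat"
      using i by (subst sum.subset_diff[of "{i, Suc i}"]) auto
    have "(\<Sum>r\<in>{1..n} - {i, Suc i}. r * ?l r) = (\<Sum>r\<in>{1..n} - {i, Suc i}. r * l r)"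
      by (rule sum.cong) auto
    then have "(\<Sum>r = 1..n. r * ?l r) < (\<Sum>r = 1..n. r * l r)"
      unfolding split using i by simp
    then show ?thesis using less.hyps[of ?l F'] F' less.prems by simp
  next
    case False
    have "l k \<le> l r" if "r \<le> k" "1 \<le> r" "k \<le> n" for r k
      using that
    proof (induction k rule: dec_induct)
      case (step k)
      then show ?case using False by (metis Suc_leD Suc_le_eq le_trans not_le)
    qed simp
    then show ?thesis
      using charge_partition[OF less.prems(1), of 1 arr] less.prems by (simp add: pairs_def)
  qed
qed

section \<open>From boxes, triples and the two-line array to \<open>good\<close>,
  \<open>pairs\<close> and \<open>arr_less\<close>\<close>

text \<open>\<open>insort_key\<close> puts \<open>p\<close> in front of equal entries, whose column
  numbers are at most \<open>snd p\<close>; as the pairs differ, they are smaller.\<close>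

lemma sorted_arr_less_sort_key:
  "sorted_wrt (\<lambda>p q. p \<noteq> q \<and> snd q \<le> snd p) xs \<Longrightarrow> sorted_wrt arr_less (sort_key fst xs)"
proof (induction xs)
  case Nil
  then show ?case by simp
next
  case (Cons p xs)
  have "sorted_wrt arr_less (insort_key fst p ys)"
    if "sorted_wrt arr_less ys" "\<forall>q \<in> set ys. p \<noteq> q \<and> snd q \<le> snd p" for ys
    using that
    by (induction ys) (auto simp: arr_less_def set_insort_key prod_eq_iff)
  then show ?case using Cons by simp
qed

lemma sorted_wrt_concat_map:
  assumes "sorted_wrt R xs" "\<And>x. x \<in> set xs \<Longrightarrow> sorted_wrt S (f x)"
    "\<And>x y p q. x \<in> set xs \<Longrightarrow> y \<in> set xs \<Longrightarrow> R x y \<Longrightarrow> p \<in> set (f x) \<Longrightarrow> q \<in> set (f y) \<Longrightarrow> S p q"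
  shows "sorted_wrt S (concat (map f xs))"
  using assms
proof (induction xs)
  case (Cons x xs)
  have "sorted_wrt S (concat (map f xs))"
  proof (rule Cons.IH)
    show "S p q" if "y \<in> set xs" "z \<in> set xs" "R y z" "p \<in> set (f y)" "q \<in> set (f z)" for y z p q
      using Cons.prems(3)[of y z p q] that by simp
  qed (use Cons.prems(1,2) in auto)
  moreover have "S p q" if "p \<in> set (f x)" "y \<in> set xs" "q \<in> set (f y)" for p y q
    using Cons.prems(1) Cons.prems(3)[of x y p q] that by simp
  ultimately show ?case using Cons.prems(2) by (auto simp: sorted_wrt_append)
qed simp

text \<open>Both types allow the same three orders, the rotations of one cyclic word. The only tie
  left is \<open>F a = F b\<close>, where \<open>b\<close> counts as smaller, matching the inclusive
  start of \<open>before\<close>.\<close>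

lemma before_if_inversion:
  assumes "inversion_A F (a, b, c) \<or> inversion_B F (a, b, c)" "F c \<noteq> F a" "F c \<noteq> F b"
  shows "before (F a) (F b) (F c)"
proof -
  let ?S = "{[Box_a, Box_c, Box_b], [Box_c, Box_b, Box_a], [Box_b, Box_a, Box_c]}"
  have "rotate i [Box_a, Box_c, Box_b] \<in> ?S" "rotate i [Box_c, Box_b, Box_a] \<in> ?S" for i
    by (induction i) (auto simp: rotate_def)
  then have "increasing_order F (a, b, c) \<in> ?S"
    using assms(1) unfolding inversion_A_def inversion_B_def by metis
  then show ?thesis
    using assms(2,3) by (auto simp: before_def split: if_splits)
qed

text \<open>In triples of both types, \<open>c\<close> is in attacking position to \<open>a\<close>
  and to \<open>b\<close>; hence its entry differs from theirs and
  \<open>before_if_inversion\<close> applies.\<close>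

lemma good_CoInvFree:
  assumes F: "F \<in> CoInvFree \<alpha> (w0 (length \<alpha>))"
  shows "good (length \<alpha>) (part \<alpha>) (\<lambda>r j. F (r, j))"
proof -
  let ?n = "length \<alpha>" and ?l = "part \<alpha>"
  have fil: "is_filling \<alpha> (w0 ?n) F" and non: "non_attacking \<alpha> F"
    and tA: "\<And>t. t \<in> type_A_triples \<alpha> \<Longrightarrow> inversion_A F t"
    and tB: "\<And>t. t \<in> type_B_triples \<alpha> \<Longrightarrow> inversion_B F t"
    using F by (auto simp: CoInvFree_def)
  have base: "F (r, 0) = Suc ?n - r" if "1 \<le> r" "r \<le> ?n" for r
    using fil that by (auto simp: is_filling_def w0_def rev_nth simp del: upt_Suc)
  have bound: "F (r, j) \<le> ?n" if "1 \<le> r" "r \<le> ?n" "j \<le> ?l r" for r j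
    using fil base[of r] that by (cases "j = 0") (auto simp: is_filling_def diagram_def aug_diagram_def)
  have noatt: "F u \<noteq> F v" if "u \<in> aug_diagram \<alpha>" "v \<in> aug_diagram \<alpha>" "u \<noteq> v"
    "snd u = snd v \<or> snd v = snd u + 1 \<and> fst v > fst u" for u v
    using non that unfolding non_attacking_def attack_def by blast
  have A: "before (F (r, j)) (F (r, Suc j)) (F (k, Suc j))"
    if "1 \<le> r" "r < k" "k \<le> ?n" "?l k \<le> ?l r" "j < ?l k" for r k j
  proof -
    have d: "(r, j) \<in> aug_diagram \<alpha>" "(r, Suc j) \<in> aug_diagram \<alpha>" "(k, Suc j) \<in> aug_diagram \<alpha>"
      using that by (auto simp: aug_diagram_def)
    then have "((r, Suc j - 1), (r, Suc j), (k, Suc j)) \<in> type_A_triples \<alpha>"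
      unfolding type_A_triples_def mem_Collect_eq
      using that by (intro exI[of _ r] exI[of _ k] exI[of _ "Suc j"]) auto
    then have "inversion_A F ((r, j), (r, Suc j), (k, Suc j))"
      using tA by fastforce
    moreover have "F (k, Suc j) \<noteq> F (r, j)" "F (k, Suc j) \<noteq> F (r, Suc j)"
      using noatt[of "(r, j)" "(k, Suc j)"] noatt[of "(r, Suc j)" "(k, Suc j)"] d that by auto
    ultimately show ?thesis using before_if_inversion by blast
  qed
  have B: "before (F (r, j)) (F (r, Suc j)) (F (k, j))"
    if "1 \<le> k" "k < r" "r \<le> ?n" "?l k < ?l r" "j \<le> ?l k" for r k j
  proof -
    have d: "(r, j) \<in> aug_diagram \<alpha>" "(r, Suc j) \<in> aug_diagram \<alpha>" "(k, j) \<in> aug_diagram \<alpha>"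
      using that by (auto simp: aug_diagram_def)
    have "((r, Suc j - 1), (r, Suc j), (k, Suc j - 1)) \<in> type_B_triples \<alpha>"
      unfolding type_B_triples_def mem_Collect_eq
      using that d by (intro exI[of _ r] exI[of _ k] exI[of _ "Suc j"]) auto
    then have "inversion_B F ((r, j), (r, Suc j), (k, j))"
      using tB by fastforce
    moreover have "F (k, j) \<noteq> F (r, j)" "F (k, j) \<noteq> F (r, Suc j)"
      using noatt[of "(k, j)" "(r, j)"] noatt[of "(k, j)" "(r, Suc j)"] d that by auto
    ultimately show ?thesis using before_if_inversion by blast
  qed
  show ?thesis
    unfolding good_def using base bound A B by blast
qed

lemma part_le_foldr_max: "1 \<le> r \<Longrightarrow> r \<le> length \<alpha> \<Longrightarrow> part \<alpha> r \<le> foldr max \<alpha> 0"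
proof -
  have "x \<le> foldr max \<alpha> 0" if "x \<in> set \<alpha>" for x
    using that by (induction \<alpha>) auto
  then show "1 \<le> r \<Longrightarrow> r \<le> length \<alpha> \<Longrightarrow> part \<alpha> r \<le> foldr max \<alpha> 0"
    by (simp add: part_def)
qed

lemma set_two_line_array:
  "set (two_line_array \<alpha> F) = pairs (length \<alpha>) (part \<alpha>) (\<lambda>r j. F (r, j))"
proof -
  have "(v, j) \<in> set (two_line_array \<alpha> F) \<longleftrightarrow>
      (\<exists>r. 1 \<le> j \<and> j \<le> foldr max \<alpha> 0 \<and> 1 \<le> r \<and> r \<le> length \<alpha> \<and> j \<le> part \<alpha> r \<and> v = F (r, j))" for v j
    by (auto simp: two_line_array_def less_Suc_eq_le simp del: upt_Suc split: if_splits)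
  moreover have "j \<le> foldr max \<alpha> 0" if "1 \<le> r" "r \<le> length \<alpha>" "j \<le> part \<alpha> r" for r j
    using part_le_foldr_max[of r \<alpha>] that by simp
  ultimately have "p \<in> set (two_line_array \<alpha> F) \<longleftrightarrow>
      p \<in> pairs (length \<alpha>) (part \<alpha>) (\<lambda>r j. F (r, j))" for p
    unfolding pairs_def by (cases p) blast
  then show ?thesis by blast
qed

lemma sorted_two_line_array:
  assumes "non_attacking \<alpha> F"
  shows "sorted_wrt arr_less (two_line_array \<alpha> F)"
  unfolding two_line_array_def
proof (rule sorted_arr_less_sort_key, rule sorted_wrt_concat_map[where R = "(>)"])
  show "sorted_wrt (>) (rev [1..<Suc (foldr max \<alpha> 0)])"
    by (simp add: sorted_wrt_rev del: upt_Suc)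
next
  fix j
  show "sorted_wrt (\<lambda>p q. p \<noteq> q \<and> snd q \<le> snd p)
     (concat (map (\<lambda>r. if j \<le> part \<alpha> r then [(F (r, j), j)] else []) [1..<Suc (length \<alpha>)]))"
  proof (rule sorted_wrt_concat_map[where R = "(<)"])
    fix r k p q
    assume "r \<in> set [1..<Suc (length \<alpha>)]" "k \<in> set [1..<Suc (length \<alpha>)]" "r < k"
      "p \<in> set (if j \<le> part \<alpha> r then [(F (r, j), j)] else [])"
      "q \<in> set (if j \<le> part \<alpha> k then [(F (k, j), j)] else [])"
    then show "p \<noteq> q \<and> snd q \<le> snd p"
      using assms unfolding non_attacking_def attack_def aug_diagram_def
      by (fastforce simp del: upt_Suc split: if_splits)
  qed (auto simp del: upt_Suc)
qed (auto simp del: upt_Suc split: if_splits)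

lemma maj_eq_sum_row_maj:
  "maj \<alpha> F = (\<Sum>r = 1..length \<alpha>. row_maj (\<lambda>j. F (r, j)) (part \<alpha> r))"
proof -
  let ?g = "\<lambda>(r, j). if F (r, j) < F (r, Suc j) then part \<alpha> r - j else 0"
  have leg: "leg \<alpha> (r, Suc j) + 1 = part \<alpha> r - j" if "1 \<le> r" "r \<le> length \<alpha>" "j < part \<alpha> r" for r j
  proof -
    have "{i. Suc j < i \<and> (r, i) \<in> diagram \<alpha>} = {Suc j<..part \<alpha> r}"
      using that by (auto simp: diagram_def aug_diagram_def)
    then show ?thesis using that by (simp add: leg_def)
  qed
  let ?D = "SIGMA r:{1..length \<alpha>}. {..<part \<alpha> r}"
  have "(\<Sum>r = 1..length \<alpha>. row_maj (\<lambda>j. F (r, j)) (part \<alpha> r)) = sum ?g ?D"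
    unfolding row_maj_def by (subst sum.Sigma) auto
  also have "\<dots> = (\<Sum>(r, j) \<in> {p \<in> ?D. F p < F (fst p, Suc (snd p))}. part \<alpha> r - j)"
    by (subst sum.inter_filter) (auto intro!: sum.cong)
  also have "\<dots> = maj \<alpha> F"
    unfolding maj_def
    \<comment> \<open>\<open>maj\<close> indexes a descent by its own box, \<open>row_maj\<close> by
      the column to its left.\<close>
    by (rule sum.reindex_bij_witness[of _ "\<lambda>(r, j). (r, j - 1)" "\<lambda>(r, j). (r, Suc j)"])
      (auto simp: descents_def diagram_def aug_diagram_def leg simp del: One_nat_def)
  finally show ?thesis by simp
qed

theorem theorem5p2:
  fixes \<alpha> :: "nat list" and F :: "nat \<times> nat \<Rightarrow> nat"
  assumes "F \<in> CoInvFree \<alpha> (w0 (length \<alpha>))"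
  shows "charge (cw \<alpha> F) = maj \<alpha> F"
proof -
  have "non_attacking \<alpha> F" using assms by (simp add: CoInvFree_def)
  then show ?thesis
    using charge_good[OF good_CoInvFree[OF assms] sorted_two_line_array set_two_line_array]
    by (simp add: cw_def maj_eq_sum_row_maj)
qed

end
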